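(* Let $1<p<2$, $p'=p/(p-1)$ and $K=(p-1)^{-p}$. Define $B:(0,\infty)^2\to\mathbb{R}$ by $$B(x,z)=xz\left[\frac{p-1}{p}\,\varphi(x^{1-p}z)+\frac{2-p}{p(p-1)}+\frac{1}{p(p-1)\,\varphi(x^{1-p}z)}\right],$$ where, for $s>0$, $\varphi(s)$ is the unique positive number satisfying $\varphi(s)(1+\varphi(s))^{p-2}=p^{p-2}s$. Then $B$ satisfies the following four conditions: 1. $B(x,z)\geq xz$ for all $x,z>0$. 2. $B(x,z)\leq \dfrac{Kx^p}{p}+\dfrac{z^{p'}}{p'}$ for all $x,z>0$. 3. For all $x,z>0$, $$\frac{B_{xx}(x,z)}{|B_{xz}(x,z)|+1}\leq \frac{B_x(x,z)}{x}\quad\text{and}\quad \frac{B_{zz}(x,z)}{|B_{xz}(x,z)|+1}\leq \frac{B_z(x,z)}{z}.$$ 4. For all $x,z>0$ and all $h,k\in\mathbb{R}$, $$B_{xx}(x,z)h^2+2B_{xz}(x,z)hk+B_{zz}(x,z)k^2\geq 2|h||k|.$$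
   Context: Subscripts on $B$ denote partial derivatives. The function $\varphi$ is well defined and smooth on $(0,\infty)$, because $u\mapsto u(1+u)^{p-2}$ is a smooth strictly increasing bijection of $(0,\infty)$ onto itself with positive derivative. With $p^*=\max\{p,p'\}$, one has $K=(p^*-1)^p$. *)

theory Defs
  imports "HOL-Analysis.Analysis"
begin

definition phi :: "real \<Rightarrow> real \<Rightarrow> real" where
  "phi p s = (THE u. 0 < u \<and> u * (1 + u) powr (p - 2) = p powr (p - 2) * s)"

definition B :: "real \<Rightarrow> real \<Rightarrow> real \<Rightarrow> real" where
  "B p x z = x * z * ((p - 1) / p * phi p (x powr (1 - p) * z)
                      + (2 - p) / (p * (p - 1))
                      + 1 / (p * (p - 1) * phi p (x powr (1 - p) * z)))"

definition d_x :: "(real \<Rightarrow> real \<Rightarrow> real) \<Rightarrow> real \<Rightarrow> real \<Rightarrow> real" where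
  "d_x F x z = deriv (\<lambda>t. F t z) x"

definition d_z :: "(real \<Rightarrow> real \<Rightarrow> real) \<Rightarrow> real \<Rightarrow> real \<Rightarrow> real" where
  "d_z F x z = deriv (\<lambda>t. F x t) z"

text \<open>
  For \<^prop>\<open>1 < p\<close>, \<^prop>\<open>p < 2\<close> the description operators hidden in \<^const>\<open>phi\<close> and
  \<^const>\<open>deriv\<close> are harmless: on the positive reals \<^const>\<open>phi\<close> is well defined
  (\<open>phi_ex1\<close>), and it is differentiable with a derivative that is again an elementary
  expression in \<^const>\<open>phi\<close> (\<open>phi_deriv\<close>). Hence all partial derivatives of
  \<^const>\<open>B\<close> exist on the open positive quadrant.
\<close>

lemma phi_aux_deriv:
  fixes p u :: real
  assumes "0 \<le> u"
  shows "((\<lambda>u. u * (1 + u) powr (p - 2)) has_real_derivative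
           (1 + u) powr (p - 3) * (1 + (p - 1) * u)) (at u)"
proof -
  have e: "(1 + u) powr (p - 2) = (1 + u) powr (p - 3) * (1 + u)"
    using assms powr_add[of "1 + u" "p - 3" 1] by simp
  show ?thesis
    using assms by (auto intro!: derivative_eq_intros simp: e algebra_simps)
qed

lemma phi_aux_strict_mono:
  fixes p u v :: real
  assumes "1 < p" "0 \<le> u" "u < v"
  shows "u * (1 + u) powr (p - 2) < v * (1 + v) powr (p - 2)"
proof (rule DERIV_pos_imp_increasing[OF \<open>u < v\<close>])
  fix w assume "u \<le> w" "w \<le> v"
  then have "0 \<le> w" using assms by simp
  then have "0 < (1 + w) powr (p - 3) * (1 + (p - 1) * w)"
    using assms by (intro mult_pos_pos add_pos_nonneg) auto
  then show "\<exists>y. ((\<lambda>u. u * (1 + u) powr (p - 2)) has_real_derivative y) (at w) \<and> 0 < y"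
    using phi_aux_deriv[OF \<open>0 \<le> w\<close>] by blast
qed

lemma phi_ex1:
  fixes p s :: real
  assumes "1 < p" "p < 2" "0 < s"
  shows "\<exists>!u. 0 < u \<and> u * (1 + u) powr (p - 2) = p powr (p - 2) * s"
proof -
  let ?g = "\<lambda>u::real. u * (1 + u) powr (p - 2)"
  define c where "c = p powr (p - 2) * s"
  have c: "0 < c" using assms by (simp add: c_def)
  define M where "M = max 1 ((c * 2 powr (2 - p)) powr (1 / (p - 1)))"
  have M: "1 \<le> M" by (simp add: M_def)
  have "c * 2 powr (2 - p) = ((c * 2 powr (2 - p)) powr (1 / (p - 1))) powr (p - 1)"
    using assms c by (simp add: powr_powr)
  also have "\<dots> \<le> M powr (p - 1)"
    using assms by (intro powr_mono2) (auto simp: M_def)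
  finally have "c * 2 powr (2 - p) * 2 powr (p - 2) \<le> M powr (p - 1) * 2 powr (p - 2)"
    by (rule mult_right_mono) simp
  moreover have "2 powr (2 - p) * 2 powr (p - 2) = (1::real)"
    by (simp flip: powr_add)
  ultimately have "c \<le> M powr (p - 1) * 2 powr (p - 2)"
    by (simp add: mult.assoc)
  also have "M powr (p - 1) = M * M powr (p - 2)"
    using M powr_add[of M 1 "p - 2"] by simp
  also have "M * M powr (p - 2) * 2 powr (p - 2) = M * (2 * M) powr (p - 2)"
    using M by (simp add: powr_mult)
  also have "\<dots> \<le> ?g M"
    using M assms by (intro mult_left_mono powr_mono2') auto
  finally have gM: "c \<le> ?g M" .
  have "continuous_on {0..M} ?g"
    by (intro continuous_intros) auto
  then obtain u where u: "0 \<le> u" "?g u = c"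
    using IVT'[of ?g 0 c M] gM c M by auto
  with c have "0 < u" by (cases "u = 0") auto
  show ?thesis
  proof (rule ex1I[of _ u])
    show "0 < u \<and> ?g u = p powr (p - 2) * s"
      using u \<open>0 < u\<close> by (simp add: c_def)
  next
    fix v assume v: "0 < v \<and> ?g v = p powr (p - 2) * s"
    then show "v = u"
      using phi_aux_strict_mono[OF \<open>1 < p\<close>, of u v] phi_aux_strict_mono[OF \<open>1 < p\<close>, of v u]
        u \<open>0 < u\<close> by (cases u v rule: linorder_cases) (auto simp: c_def)
  qed
qed

lemma phi_spec:
  fixes p s :: real
  assumes "1 < p" "p < 2" "0 < s"
  shows "0 < phi p s" "phi p s * (1 + phi p s) powr (p - 2) = p powr (p - 2) * s"
  using theI'[OF phi_ex1[OF assms]] by (auto simp: phi_def)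

lemma phi_deriv:
  fixes p s :: real
  assumes p: "1 < p" "p < 2" and "0 < s"
  shows "(phi p has_real_derivative
           p powr (p - 2) * (1 + phi p s) powr (3 - p) / (1 + (p - 1) * phi p s)) (at s)"
proof -
  let ?f = "\<lambda>u. u * (1 + u) powr (p - 2) / p powr (p - 2)"
  let ?D = "(1 + phi p s) powr (p - 3) * (1 + (p - 1) * phi p s) / p powr (p - 2)"
  note ps = phi_spec[OF p \<open>0 < s\<close>]
  have pos: "0 < 1 + (p - 1) * phi p s"
    using p ps(1) by (intro add_pos_nonneg) auto
  have "(phi p has_derivative (*) (inverse ?D)) (at s)"
  proof (rule has_derivative_inverse_strong_x[where f = ?f and S = "{0<..}" and f' = "(*) ?D"])
    show "(?f has_derivative (*) ?D) (at (phi p s))"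
      unfolding has_field_derivative_def[symmetric]
      using phi_aux_deriv[of "phi p s" p] ps(1) by (intro DERIV_cdivide) auto
    have "?D \<noteq> 0" using p ps(1) pos by simp
    then have "?D * inverse ?D = 1" by (rule right_inverse)
    then show "(*) ?D \<circ> (*) (inverse ?D) = id"
      by (simp only: fun_eq_iff o_apply id_apply mult.assoc[symmetric] mult_1_left simp_thms)
    show "continuous_on {0<..} ?f"
      using p by (intro continuous_intros) auto
    show "?f (phi p s) = s" using ps(2) p by simp
    fix u :: real assume u: "u \<in> {0<..}"
    then have fu: "0 < ?f u" using p by simp
    have "0 < u \<and> u * (1 + u) powr (p - 2) = p powr (p - 2) * ?f u"
      using p u by simp
    then show "phi p (?f u) = u"
      using phi_ex1[OF p fu] phi_spec[OF p fu] by blast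
  qed (use ps in auto)
  then have "(phi p has_real_derivative inverse ?D) (at s)"
    by (simp only: has_field_derivative_def)
  also have "inverse ?D = p powr (p - 2) * (1 + phi p s) powr (3 - p) / (1 + (p - 1) * phi p s)"
    using powr_minus[of "1 + phi p s" "p - 3"] by (simp add: inverse_mult_distrib divide_inverse mult_ac)
  finally show ?thesis .
qed

end

theory Submission
  imports Defs
begin

text \<open>
  Put \<open>u = \<phi>(x\<^sup>1\<^sup>-\<^sup>p z)\<close> and \<open>R = (1 + u) / (1 + (p - 1) u)\<close>. The defining equation of \<open>\<phi>\<close> makes
  \<open>R\<close> the logarithmic derivative of \<open>\<phi>\<close>, which collapses the partial derivatives of \<open>B\<close> to
  \<open>B\<^sub>x = z ((2 - p) + 1/u) / (p - 1)\<close>, \<open>B\<^sub>z = x u\<close>, \<open>B\<^sub>x\<^sub>x = z R / (x u)\<close>, \<open>B\<^sub>z\<^sub>z = x u R / z\<close> and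
  \<open>B\<^sub>x\<^sub>z = R - 1 \<ge> 0\<close>. Conditions 3 and 4 are then immediate, the latter because
  \<open>B\<^sub>x\<^sub>x B\<^sub>z\<^sub>z = R\<^sup>2 = (B\<^sub>x\<^sub>z + 1)\<^sup>2\<close>. Condition 1 is the arithmetic-geometric mean inequality. For
  condition 2, homogeneity reduces to \<open>x = 1\<close>, where the difference of the two sides has
  derivative \<open>z powr (1 / (p - 1)) - \<phi>(z)\<close>; this changes sign from minus to plus at the point
  where \<open>\<phi> = 1 / (p - 1)\<close>, and there the difference vanishes.
\<close>

section \<open>Logarithmic derivatives of \<open>phi\<close> and of its scaled versions\<close>

lemma phi_unique:
  assumes "1 < p" "p < 2" "0 < s" "0 < u" "u * (1 + u) powr (p - 2) = p powr (p - 2) * s"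
  shows "phi p s = u"
  using phi_ex1[OF assms(1-3)] phi_spec[OF assms(1-3)] assms(4,5) by blast

text \<open>Multiplying the derivative by \<open>s\<close> lets the defining equation absorb
  \<open>p powr (p - 2) * s\<close>; the exponents \<open>p - 2\<close> and \<open>3 - p\<close> add
  up to 1, so what remains is rational in \<open>phi p s\<close>.\<close>

lemma phi_log_deriv:
  assumes p: "1 < p" "p < 2" and s: "0 < s"
  shows "(phi p has_real_derivative
           phi p s * ((1 + phi p s) / (1 + (p - 1) * phi p s)) / s) (at s)"
proof -
  let ?u = "phi p s"
  note u = phi_spec[OF p s]
  have "p powr (p - 2) * (1 + ?u) powr (3 - p) * s
      = ?u * ((1 + ?u) powr (p - 2) * (1 + ?u) powr (3 - p))"
    using u(2) by (simp add: algebra_simps)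
  also have "(1 + ?u) powr (p - 2) * (1 + ?u) powr (3 - p) = 1 + ?u"
    using u(1) by (simp flip: powr_add)
  finally have "p powr (p - 2) * (1 + ?u) powr (3 - p) = ?u * (1 + ?u) / s"
    using s by (simp add: field_simps)
  then show ?thesis
    using phi_deriv[OF p s] by (simp add: mult_ac)
qed

lemma phi_scaled_deriv_x:
  assumes p: "1 < p" "p < 2" and "0 < x" "0 < z"
  defines "u \<equiv> phi p (x powr (1 - p) * z)"
  shows "((\<lambda>t. phi p (t powr (1 - p) * z)) has_real_derivative
           (1 - p) * u * ((1 + u) / (1 + (p - 1) * u)) / x) (at x)"
proof -
  have s: "0 < x powr (1 - p) * z" using assms by simp
  have "x powr (- p) = x powr (1 - p) / x"
    using \<open>0 < x\<close> powr_diff[of x "1 - p" 1] by simp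
  then have "((\<lambda>t. t powr (1 - p) * z) has_real_derivative
          (1 - p) * (x powr (1 - p) * z) / x) (at x)"
    using DERIV_cmult_right[OF has_real_derivative_powr[OF \<open>0 < x\<close>, of "1 - p"], of z]
    by (simp add: mult.assoc)
  from DERIV_chain2[OF phi_log_deriv[OF p s] this] \<open>0 < x\<close> \<open>0 < z\<close>
  show ?thesis by (simp add: u_def mult_ac)
qed

lemma phi_scaled_deriv_z:
  assumes p: "1 < p" "p < 2" and "0 < x" "0 < z"
  defines "u \<equiv> phi p (x powr (1 - p) * z)"
  shows "((\<lambda>t. phi p (x powr (1 - p) * t)) has_real_derivative
           u * ((1 + u) / (1 + (p - 1) * u)) / z) (at z)"
proof -
  have s: "0 < x powr (1 - p) * z" using assms by simp
  have "((\<lambda>t. x powr (1 - p) * t) has_real_derivative x powr (1 - p)) (at z)"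
    by (auto intro!: derivative_eq_intros)
  from DERIV_chain2[OF phi_log_deriv[OF p s] this] assms
  show ?thesis by (simp add: u_def)
qed

section \<open>First partial derivatives of \<open>B\<close>, one variable frozen at a time\<close>

lemma B_profile_deriv:
  fixes f :: "real \<Rightarrow> real"
  assumes "(f has_real_derivative v / t) (at t)" "0 < t" "0 < f t" "a \<noteq> 0"
  shows "((\<lambda>t. t * y * (b * f t + c + 1 / (a * f t))) has_real_derivative
           y * (b * f t + c + 1 / (a * f t)) + y * (b - 1 / (a * (f t)\<^sup>2)) * v) (at t)"
  using assms by (auto intro!: derivative_eq_intros simp: field_simps power2_eq_square)

lemma B_x_profile_deriv:
  fixes f :: "real \<Rightarrow> real"
  assumes "(f has_real_derivative v / t) (at t)" "0 < t" "0 < f t" "a \<noteq> 0"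
  shows "((\<lambda>t. y * (c + 1 / f t) / a) has_real_derivative y * (- v) / (t * a * (f t)\<^sup>2)) (at t)"
    and "((\<lambda>t. t * (c + 1 / f t) / a) has_real_derivative (c + 1 / f t - v / (f t)\<^sup>2) / a) (at t)"
  using assms by (auto intro!: derivative_eq_intros simp: field_simps power2_eq_square)

text \<open>The factor \<open>(p - 1) / p - 1 / (p * (p - 1) * u\<^sup>2)\<close> is a difference of
  squares with numerator \<open>((p - 1) * u)\<^sup>2 - 1\<close>, so it cancels the denominator
  \<open>1 + (p - 1) * u\<close>.\<close>

lemma B_x_algebra:
  fixes p u z :: real
  assumes "1 < p" "0 < u"
  shows "z * ((p - 1) / p * u + (2 - p) / (p * (p - 1)) + 1 / (p * (p - 1) * u))
       + z * ((p - 1) / p - 1 / (p * (p - 1) * u\<^sup>2)) * ((1 - p) * u * ((1 + u) / (1 + (p - 1) * u)))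
       = z * ((2 - p) + 1 / u) / (p - 1)"
proof -
  have "1 + (p - 1) * u > 0" using assms by (intro add_pos_pos) auto
  then show ?thesis using assms
    by (simp add: divide_simps) algebra
qed

lemma B_z_algebra:
  fixes p u x :: real
  assumes "1 < p" "0 < u"
  shows "x * ((p - 1) / p * u + (2 - p) / (p * (p - 1)) + 1 / (p * (p - 1) * u))
       + x * ((p - 1) / p - 1 / (p * (p - 1) * u\<^sup>2)) * (u * ((1 + u) / (1 + (p - 1) * u)))
       = x * u"
proof -
  have "1 + (p - 1) * u > 0" using assms by (intro add_pos_pos) auto
  then show ?thesis using assms
    by (simp add: divide_simps) algebra
qed

context
  fixes p x z u :: real
  assumes p: "1 < p" "p < 2" and pos: "0 < x" "0 < z"
  defines "u \<equiv> phi p (x powr (1 - p) * z)"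
begin

lemma u_pos: "0 < u"
  using phi_spec(1)[OF p] pos by (simp add: u_def)

lemma denom_pos: "0 < 1 + (p - 1) * u"
  using p u_pos by (intro add_pos_pos) auto

lemma B_has_deriv_x:
  "((\<lambda>t. B p t z) has_real_derivative z * ((2 - p) + 1 / u) / (p - 1)) (at x)"
proof -
  have "p * (p - 1) \<noteq> 0" using p by simp
  from B_profile_deriv[OF phi_scaled_deriv_x[OF p pos] pos(1) phi_spec(1)[OF p] this,
      of z "(p - 1) / p" "(2 - p) / (p * (p - 1))"]
  show ?thesis
    using pos B_x_algebra[OF p(1) u_pos, of z]
    unfolding B_def u_def by (simp add: mult.commute[of x])
qed

lemma B_has_deriv_z:
  "((\<lambda>t. B p x t) has_real_derivative x * u) (at z)"
proof -
  have "p * (p - 1) \<noteq> 0" using p by simp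
  from B_profile_deriv[OF phi_scaled_deriv_z[OF p pos] pos(2) phi_spec(1)[OF p] this,
      of x "(p - 1) / p" "(2 - p) / (p * (p - 1))"]
  show ?thesis
    using pos B_z_algebra[OF p(1) u_pos, of x]
    unfolding B_def u_def by (simp add: mult.commute[of x])
qed

end

section \<open>Values of the first and second partial derivatives\<close>

lemma d_x_B:
  assumes "1 < p" "p < 2" "0 < x" "0 < z"
  shows "d_x (B p) x z = z * ((2 - p) + 1 / phi p (x powr (1 - p) * z)) / (p - 1)"
  unfolding d_x_def by (rule DERIV_imp_deriv[OF B_has_deriv_x[OF assms]])

lemma d_z_B:
  assumes "1 < p" "p < 2" "0 < x" "0 < z"
  shows "d_z (B p) x z = x * phi p (x powr (1 - p) * z)"
  unfolding d_z_def by (rule DERIV_imp_deriv[OF B_has_deriv_z[OF assms]])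

text \<open>The formulas for the first partial derivatives are known only on the positive half-line;
  it is open, so they may still be differentiated there.\<close>

lemma deriv_eq_on_pos:
  fixes f g :: "real \<Rightarrow> real"
  assumes "(g has_real_derivative D) (at x)" "0 < x" "\<And>t. 0 < t \<Longrightarrow> f t = g t"
  shows "deriv f x = D"
proof (rule DERIV_imp_deriv)
  show "(f has_real_derivative D) (at x)"
    by (rule has_field_derivative_transform_within_open[where S = "{0<..}", OF assms(1)])
       (use assms in auto)
qed

context
  fixes p x z u :: real
  assumes p: "1 < p" "p < 2" and pos: "0 < x" "0 < z"
  defines "u \<equiv> phi p (x powr (1 - p) * z)"
begin

lemma d_xx_B: "d_x (d_x (B p)) x z = z * ((1 + u) / (1 + (p - 1) * u)) / (x * u)"
proof -
  note u = u_pos[OF p pos, folded u_def] denom_pos[OF p pos, folded u_def]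
  have D: "((\<lambda>t. z * ((2 - p) + 1 / phi p (t powr (1 - p) * z)) / (p - 1)) has_real_derivative
          z * (- ((1 - p) * u * ((1 + u) / (1 + (p - 1) * u)))) / (x * (p - 1) * u\<^sup>2)) (at x)"
    using B_x_profile_deriv(1)[OF phi_scaled_deriv_x[OF p pos] pos(1), of "p - 1" z "2 - p"] u p
    by (simp add: u_def)
  have "z * (- ((1 - p) * u * r)) / (x * (p - 1) * u\<^sup>2) = z * r / (x * u)" for r
    using u p pos by (simp add: divide_simps) algebra
  note D[unfolded this]
  then show ?thesis
    unfolding d_x_def[of "d_x (B p)"] by (rule deriv_eq_on_pos) (simp_all add: p pos d_x_B)
qed

lemma d_zx_B: "d_z (d_x (B p)) x z = (1 + u) / (1 + (p - 1) * u) - 1"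
proof -
  note u = u_pos[OF p pos, folded u_def] denom_pos[OF p pos, folded u_def]
  have D: "((\<lambda>t. t * ((2 - p) + 1 / phi p (x powr (1 - p) * t)) / (p - 1)) has_real_derivative
          (2 - p + 1 / u - u * ((1 + u) / (1 + (p - 1) * u)) / u\<^sup>2) / (p - 1)) (at z)"
    using B_x_profile_deriv(2)[OF phi_scaled_deriv_z[OF p pos] pos(2), of "p - 1" "2 - p"] u p
    by (simp add: u_def)
  have "(2 - p + 1 / u - u * ((1 + u) / (1 + (p - 1) * u)) / u\<^sup>2) / (p - 1)
      = (1 + u) / (1 + (p - 1) * u) - 1"
    using u p by (simp add: divide_simps) algebra
  note D[unfolded this]
  then show ?thesis
    unfolding d_z_def by (rule deriv_eq_on_pos) (simp_all add: p pos d_x_B)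
qed

lemma d_zz_B: "d_z (d_z (B p)) x z = x * u * ((1 + u) / (1 + (p - 1) * u)) / z"
proof -
  have "((\<lambda>t. x * phi p (x powr (1 - p) * t)) has_real_derivative
          x * u * ((1 + u) / (1 + (p - 1) * u)) / z) (at z)"
    unfolding u_def by (rule derivative_eq_intros phi_scaled_deriv_z[OF p pos] refl)+ simp
  then show ?thesis
    unfolding d_z_def[of "d_z (B p)"] by (rule deriv_eq_on_pos) (simp_all add: p pos d_z_B)
qed

section \<open>Conditions 1, 3 and 4\<close>

lemma B_ge: "x * z \<le> B p x z"
proof -
  note u = u_pos[OF p pos, folded u_def]
  have "1 \<le> 1 / (p - 1)" using p by simp
  \<comment> \<open>Completing the square in the bracket of \<open>B\<close> leaves exactly the
    constant \<open>1 / (p - 1)\<close>.\<close>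
  also have "\<dots> \<le> 1 / (p - 1) + ((p - 1) * u - 1)\<^sup>2 / (p * (p - 1) * u)"
    using p u by simp
  also have "\<dots> = (p - 1) / p * u + (2 - p) / (p * (p - 1)) + 1 / (p * (p - 1) * u)"
    using p u by (simp add: divide_simps) algebra
  finally have "x * z * 1 \<le> x * z * \<dots>"
    using pos by (intro mult_left_mono) auto
  then show ?thesis by (simp add: B_def u_def)
qed

lemma d_xx_B_le: "d_x (d_x (B p)) x z / (\<bar>d_z (d_x (B p)) x z\<bar> + 1) \<le> d_x (B p) x z / x"
  and d_zz_B_le: "d_z (d_z (B p)) x z / (\<bar>d_z (d_x (B p)) x z\<bar> + 1) \<le> d_z (B p) x z / z"
  and hessian_B_ge: "2 * \<bar>h\<bar> * \<bar>k\<bar> \<le>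
    d_x (d_x (B p)) x z * h\<^sup>2 + 2 * d_z (d_x (B p)) x z * h * k + d_z (d_z (B p)) x z * k\<^sup>2"
proof -
  note u = u_pos[OF p pos, folded u_def] denom_pos[OF p pos, folded u_def]
  define R where "R = (1 + u) / (1 + (p - 1) * u)"
  \<comment> \<open>Consequently \<open>\<bar>R - 1\<bar> + 1 = R\<close>, and \<open>R\<close>
    cancels from both quotients of condition 3; the one for \<open>z\<close> becomes an
    equality.\<close>
  have R: "1 \<le> R"
    using u p by (simp add: R_def)
  note eqs = d_xx_B[folded R_def] d_zx_B[folded R_def] d_zz_B[folded R_def]
    d_x_B[OF p pos, folded u_def] d_z_B[OF p pos, folded u_def]
  have "1 / u * (p - 1) \<le> 1 / u * 1"
    using p u by (intro mult_left_mono) auto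
  then have "1 / u * (p - 1) \<le> (2 - p) + 1 / u" using p by linarith
  then have "1 / u \<le> ((2 - p) + 1 / u) / (p - 1)"
    using p by (simp add: pos_le_divide_eq)
  then have "z / x * (1 / u) \<le> z / x * (((2 - p) + 1 / u) / (p - 1))"
    using pos by (intro mult_left_mono) auto
  then show "d_x (d_x (B p)) x z / (\<bar>d_z (d_x (B p)) x z\<bar> + 1) \<le> d_x (B p) x z / x"
    using R unfolding eqs by (simp add: mult_ac)
  show "d_z (d_z (B p)) x z / (\<bar>d_z (d_x (B p)) x z\<bar> + 1) \<le> d_z (B p) x z / z"
    using R unfolding eqs by simp
  let ?a = "z / (x * u)" and ?b = "x * u / z"
  \<comment> \<open>The coefficients \<open>?a\<close> and \<open>?b\<close> are reciprocal, so the
    cross term of this square is exactly \<open>2 * \<bar>h * k\<bar>\<close>.\<close>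
  have "0 \<le> ?a * (\<bar>h\<bar> - ?b * \<bar>k\<bar>)\<^sup>2"
    using pos u by simp
  also have "\<dots> = ?a * h\<^sup>2 + ?b * k\<^sup>2 - 2 * \<bar>h * k\<bar>"
    using pos u by (simp add: power2_diff power_mult_distrib abs_mult field_simps power2_eq_square)
  finally have "R * (2 * \<bar>h * k\<bar>) \<le> R * (?a * h\<^sup>2 + ?b * k\<^sup>2)"
    using R by (intro mult_left_mono) auto
  \<comment> \<open>The mixed term costs at most \<open>2 * (R - 1) * \<bar>h * k\<bar>\<close> of
    the \<open>2 * R * \<bar>h * k\<bar>\<close> just gained.\<close>
  moreover have "(R - 1) * (- \<bar>h * k\<bar>) \<le> (R - 1) * (h * k)"
    using R by (intro mult_left_mono) auto
  ultimately have "2 * \<bar>h * k\<bar> \<le> R * (?a * h\<^sup>2 + ?b * k\<^sup>2) + 2 * ((R - 1) * (h * k))"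
    by (simp add: algebra_simps)
  then show "2 * \<bar>h\<bar> * \<bar>k\<bar> \<le>
    d_x (d_x (B p)) x z * h\<^sup>2 + 2 * d_z (d_x (B p)) x z * h * k + d_z (d_z (B p)) x z * k\<^sup>2"
    unfolding eqs by (simp add: abs_mult algebra_simps)
qed

end

section \<open>Condition 2: the case \<open>x = 1\<close> and homogeneity\<close>

context
  fixes p :: real
  assumes p: "1 < p" "p < 2"
begin

text \<open>This form compares \<open>s\<close> with \<open>phi p s powr (p - 1)\<close>: the base
  of the second factor lies below or above 1 according as \<open>(p - 1) * phi p s\<close>
  does.\<close>

lemma phi_powr_eq:
  assumes "0 < s"
  shows "s = phi p s powr (p - 1) * (p * phi p s / (1 + phi p s)) powr (2 - p)"
proof -
  let ?u = "phi p s"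
  note u = phi_spec[OF p assms]
  have "s = p powr (2 - p) * (p powr (p - 2) * s)"
    using p by (simp flip: powr_add mult.assoc)
  \<comment> \<open>The exponent 1 of \<open>?u\<close> is split so that the share
    \<open>2 - p\<close> can join the powers of \<open>p\<close> and \<open>1 + ?u\<close>.\<close>
  also have "\<dots> = p powr (2 - p) * (?u powr ((p - 1) + (2 - p)) * (1 + ?u) powr (p - 2))"
    using u by simp
  also have "\<dots> = ?u powr (p - 1) * (p powr (2 - p) * ?u powr (2 - p) / (1 + ?u) powr (2 - p))"
    unfolding powr_add using powr_minus_divide[of "1 + ?u" "2 - p"] by simp
  also have "\<dots> = ?u powr (p - 1) * (p * ?u / (1 + ?u)) powr (2 - p)"
    using u p by (simp add: powr_mult powr_divide)
  finally show ?thesis .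
qed

lemma powr_le_phi:
  assumes "0 < s" "(p - 1) * phi p s \<le> 1"
  shows "s powr (1 / (p - 1)) \<le> phi p s"
proof -
  let ?u = "phi p s"
  note u = phi_spec(1)[OF p assms(1)]
  have "p * ?u / (1 + ?u) \<le> 1" using u assms by (simp add: algebra_simps)
  then have "(p * ?u / (1 + ?u)) powr (2 - p) \<le> 1"
    using u p by (intro powr_le1) auto
  then have "s \<le> ?u powr (p - 1)"
    by (subst phi_powr_eq[OF assms(1)]) (simp add: mult_left_le)
  then have "s powr (1 / (p - 1)) \<le> (?u powr (p - 1)) powr (1 / (p - 1))"
    using p assms by (intro powr_mono2) auto
  then show ?thesis using p u by (simp add: powr_powr)
qed

lemma phi_le_powr:
  assumes "0 < s" "1 \<le> (p - 1) * phi p s"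
  shows "phi p s \<le> s powr (1 / (p - 1))"
proof -
  let ?u = "phi p s"
  note u = phi_spec(1)[OF p assms(1)]
  have "1 \<le> p * ?u / (1 + ?u)" using u assms by (simp add: algebra_simps)
  then have "1 \<le> (p * ?u / (1 + ?u)) powr (2 - p)"
    using p by (intro ge_one_powr_ge_zero) auto
  then have "?u powr (p - 1) * 1 \<le> ?u powr (p - 1) * (p * ?u / (1 + ?u)) powr (2 - p)"
    by (intro mult_left_mono) auto
  then have "?u powr (p - 1) \<le> s"
    using phi_powr_eq[OF assms(1)] by simp
  then have "(?u powr (p - 1)) powr (1 / (p - 1)) \<le> s powr (1 / (p - 1))"
    using p by (intro powr_mono2) auto
  then show ?thesis using p u by (simp add: powr_powr)
qed

lemma phi_mono:
  assumes "0 < s" "s \<le> t"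
  shows "phi p s \<le> phi p t"
proof (rule ccontr)
  assume "\<not> ?thesis"
  then have "phi p t < phi p s" by simp
  from phi_aux_strict_mono[OF p(1) _ this] have "p powr (p - 2) * t < p powr (p - 2) * s"
    using phi_spec[OF p, of t] phi_spec[OF p, of s] assms by simp
  with assms p show False by simp
qed

text \<open>The boundary case \<open>(p - 1) * phi p s = 1\<close> of the two comparisons above,
  where the second factor in \<open>phi_powr_eq\<close> is 1.\<close>

lemma phi_critical: "phi p ((p - 1) powr (1 - p)) = 1 / (p - 1)"
proof (rule phi_unique[OF p])
  have "1 + 1 / (p - 1) = p / (p - 1)" using p by (simp add: field_simps)
  then have "1 / (p - 1) * (1 + 1 / (p - 1)) powr (p - 2)
      = p powr (p - 2) * (1 / ((p - 1) powr 1 * (p - 1) powr (p - 2)))"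
    using p by (simp add: powr_divide)
  also have "(p - 1) powr 1 * (p - 1) powr (p - 2) = (p - 1) powr (p - 1)"
    unfolding powr_add[symmetric] by simp
  also have "1 / \<dots> = (p - 1) powr (1 - p)"
    using powr_minus_divide[of "p - 1" "p - 1"] by simp
  finally show "1 / (p - 1) * (1 + 1 / (p - 1)) powr (p - 2) = p powr (p - 2) * (p - 1) powr (1 - p)" .
qed (use p in auto)

lemma B_le_one:
  assumes s: "0 < s"
  shows "B p 1 s \<le> (p - 1) powr (- p) / p + s powr (p / (p - 1)) * ((p - 1) / p)"
proof -
  define g where "g = (\<lambda>s. (p - 1) powr (- p) / p + s powr (p / (p - 1)) * ((p - 1) / p) - B p 1 s)"
  \<comment> \<open>The point where the derivative of \<open>g\<close> changes sign.\<close>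
  define s0 where "s0 = (p - 1) powr (1 - p)"
  have s0: "0 < s0" using p by (simp add: s0_def)
  have phi0: "phi p s0 = 1 / (p - 1)" using phi_critical by (simp add: s0_def)
  have g_deriv: "(g has_real_derivative t powr (1 / (p - 1)) - phi p t) (at t)" if t: "0 < t" for t
  proof -
    have "p / (p - 1) - 1 = 1 / (p - 1)" using p by (simp add: field_simps)
    then have "((\<lambda>s. s powr (p / (p - 1)) * ((p - 1) / p)) has_real_derivative t powr (1 / (p - 1))) (at t)"
      using DERIV_cmult_right[OF has_real_derivative_powr[OF t, of "p / (p - 1)"], of "(p - 1) / p"] p
      by simp
    moreover have "(B p 1 has_real_derivative phi p t) (at t)"
      using B_has_deriv_z[OF p _ t, of 1] by simp
    ultimately show ?thesis
      unfolding g_def using DERIV_diff DERIV_add[OF DERIV_const] by fastforce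
  qed
  \<comment> \<open>At \<open>s0\<close> all three terms of \<open>g\<close> are multiples of
    \<open>(p - 1) powr (- p)\<close>, with coefficients \<open>1 / p\<close>,
    \<open>(p - 1) / p\<close> and \<open>- 1\<close>, which sum to 0.\<close>
  have "(1 - p) * (p / (p - 1)) = - p" using p by (simp add: divide_simps) algebra
  then have a: "s0 powr (p / (p - 1)) = (p - 1) powr (- p)"
    by (simp add: s0_def powr_powr)
  have b: "s0 = (p - 1) * (p - 1) powr (- p)"
    using p powr_add[of "p - 1" 1 "- p"] by (simp add: s0_def)
  have "B p 1 s0 = s0 / (p - 1)"
    unfolding B_def using p by (simp add: phi0 divide_simps)
  also have "\<dots> = (p - 1) powr (- p)"
    using p by (subst b) simp
  finally have "g s0 = 0"
    unfolding g_def a using p by (simp add: field_simps)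
  \<comment> \<open>Monotonicity of \<open>phi\<close> decides on each side of \<open>s0\<close>
    which comparison with \<open>t powr (1 / (p - 1))\<close> applies, so \<open>s0\<close> is a
    global minimum.\<close>
  have "g s0 \<le> g s"
  proof (cases "s0 \<le> s")
    case True
    show ?thesis
    proof (rule DERIV_nonneg_imp_nondecreasing[OF True])
      fix t assume t: "s0 \<le> t" "t \<le> s"
      then have "0 < t" "1 / (p - 1) \<le> phi p t" using s0 phi_mono[of s0 t] phi0 by auto
      then have "phi p t \<le> t powr (1 / (p - 1))"
        using p by (intro phi_le_powr) (auto simp: field_simps)
      then show "\<exists>y. (g has_real_derivative y) (at t) \<and> 0 \<le> y"
        using g_deriv[OF \<open>0 < t\<close>] by (intro exI conjI) auto
    qed
  next
    case False
    show ?thesis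
    proof (rule DERIV_nonpos_imp_nonincreasing[of s s0 g])
      show "s \<le> s0" using False by simp
      fix t assume t: "s \<le> t" "t \<le> s0"
      then have "0 < t" "phi p t \<le> 1 / (p - 1)" using s phi_mono[of t s0] phi0 by auto
      then have "t powr (1 / (p - 1)) \<le> phi p t"
        using p by (intro powr_le_phi) (auto simp: field_simps)
      then show "\<exists>y. (g has_real_derivative y) (at t) \<and> y \<le> 0"
        using g_deriv[OF \<open>0 < t\<close>] by (intro exI conjI) auto
    qed
  qed
  with \<open>g s0 = 0\<close> show ?thesis by (simp add: g_def)
qed

text \<open>The argument \<open>x powr (1 - p) * z\<close> of \<open>phi\<close> is unchanged when
  \<open>(x, z)\<close> is replaced by \<open>(1, x powr (1 - p) * z)\<close>; only the prefactor
  \<open>x * z\<close> rescales.\<close>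

lemma B_homogeneous:
  assumes "0 < x"
  shows "B p x z = x powr p * B p 1 (x powr (1 - p) * z)"
proof -
  have "x powr p * x powr (1 - p) = x"
    using assms by (simp flip: powr_add)
  then show ?thesis
    by (simp add: B_def flip: mult.assoc)
qed

lemma B_le:
  assumes "0 < x" "0 < z"
  shows "B p x z \<le> (p - 1) powr (- p) * x powr p / p + z powr (p / (p - 1)) / (p / (p - 1))"
proof -
  let ?s = "x powr (1 - p) * z"
  \<comment> \<open>By this exponent identity the bound in condition 2 has the same homogeneity as
    \<open>B\<close>.\<close>
  have "(1 - p) * (p / (p - 1)) = - p"
    using p by (simp add: divide_simps) algebra
  then have "?s powr (p / (p - 1)) = x powr (- p) * z powr (p / (p - 1))"
    using assms by (simp add: powr_mult powr_powr)
  then have s: "x powr p * ?s powr (p / (p - 1)) = z powr (p / (p - 1))"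
    using assms by (simp flip: powr_add mult.assoc)
  have "B p x z \<le> x powr p * ((p - 1) powr (- p) / p + ?s powr (p / (p - 1)) * ((p - 1) / p))"
    unfolding B_homogeneous[OF assms(1), of z] using assms by (intro mult_left_mono B_le_one) auto
  also have "\<dots> = (p - 1) powr (- p) * x powr p / p + x powr p * ?s powr (p / (p - 1)) * ((p - 1) / p)"
    by (simp only: distrib_left mult_ac times_divide_eq_right)
  finally show ?thesis unfolding s by simp
qed

end

theorem theorem3p1:
  fixes p p' K :: real
  assumes "1 < p" and "p < 2"
    and "p' = p / (p - 1)"
    and "K = (p - 1) powr (- p)"
  shows
    "(\<forall>x>0. \<forall>z>0. B p x z \<ge> x * z) \<and>
     (\<forall>x>0. \<forall>z>0. B p x z \<le> K * x powr p / p + z powr p' / p') \<and>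
     (\<forall>x>0. \<forall>z>0.
        d_x (d_x (B p)) x z / (\<bar>d_z (d_x (B p)) x z\<bar> + 1) \<le> d_x (B p) x z / x \<and>
        d_z (d_z (B p)) x z / (\<bar>d_z (d_x (B p)) x z\<bar> + 1) \<le> d_z (B p) x z / z) \<and>
     (\<forall>x>0. \<forall>z>0. \<forall>h k.
        d_x (d_x (B p)) x z * h\<^sup>2 + 2 * d_z (d_x (B p)) x z * h * k + d_z (d_z (B p)) x z * k\<^sup>2
          \<ge> 2 * \<bar>h\<bar> * \<bar>k\<bar>)"
  using assms B_ge[OF assms(1,2)] B_le[OF assms(1,2)] d_xx_B_le[OF assms(1,2)] d_zz_B_le[OF assms(1,2)]
    hessian_B_ge[OF assms(1,2)] by auto

end
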